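(* Let $\Omega\subset\mathbb{R}^2$ be a bounded, Lipschitz domain that is simply connected, and let $p\in W^{2,2}(\Omega)$. Consider the dual problem $$\max_{\substack{\varphi:\mathbb{R}^2\to\mathbb{R}\\ \varphi\text{ is convex}\\ \varphi=\frac12|x|^2\text{ on }\mathbb{R}^2\setminus\Omega}}\ \int_\Omega\Big(\varphi-\frac12|x|^2\Big)\det\nabla\nabla p\,dx .$$ If $\det\nabla\nabla p\ge0$ a.e., the dual problem is solved by the largest convex extension $\varphi_+$ of $\frac12|x|^2$ into $\Omega$. It satisfies $$\varphi_+(x)=\min_{\{y_i\}\subset\partial\Omega}\ \sum_{i}\theta_i\frac12|y_i|^2\qquad\text{for }x\in\Omega,$$ where the minimization is taken over all pairs and triples $\{y_i\}\subset\partial\Omega$ such that $x=\sum_i\theta_iy_i$ where $\{\theta_i\}\subset(0,1)$ satisfies $\sum_i\theta_i=1$. If $\det\nabla\nabla p\le0$ a.e., the dual problem is solved by the smallest convex extension $\varphi_-$ of $\frac12|x|^2$ into $\Omega$. It satisfies $$\varphi_-(x)=\frac12|x|^2-\frac12d_{\partial\Omega}^2(x)\quad\text{where}\quad d_{\partial\Omega}(x)=\min_{y\in\partial\Omega}|x-y|,\qquad\text{for }x\in\Omega.$$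
   Context: A convex extension of $\frac12|x|^2$ into $\Omega$ is a convex function $\varphi:\mathbb{R}^2\to\mathbb{R}$ with $\varphi(x)=\frac12|x|^2$ for all $x\in\mathbb{R}^2\setminus\Omega$. The largest (respectively smallest) one, $\varphi_+$ (respectively $\varphi_-$), is the pointwise supremum (respectively infimum) of all such functions, and is itself such a function. *)

theory Defs
  imports "HOL-Analysis.Analysis"
begin

section \<open>Lipschitz domains\<close>

text \<open>Near each boundary point, in coordinates with respect to some orthonormal frame
  \<open>e, n\<close> of the plane, the domain is the strict epigraph of a Lipschitz function;
  in particular it lies on one side of its boundary only.\<close>

definition lipschitz_domain :: "(real^2) set \<Rightarrow> bool" where
  "lipschitz_domain \<Omega> \<longleftrightarrow> open \<Omega> \<and> connected \<Omega> \<and> \<Omega> \<noteq> {} \<and>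
     (\<forall>z\<in>frontier \<Omega>. \<exists>U e n g L.
        open U \<and> z \<in> U \<and> norm e = 1 \<and> norm n = 1 \<and> e \<bullet> n = 0 \<and>
        L-lipschitz_on UNIV (g :: real \<Rightarrow> real) \<and>
        \<Omega> \<inter> U = {x \<in> U. g (x \<bullet> e) < x \<bullet> n})"


section \<open>Weak derivatives and the Sobolev spaces \<open>W\<^sup>k\<^sup>,\<^sup>2\<close>\<close>

definition partial :: "'n \<Rightarrow> (real^'n \<Rightarrow> real) \<Rightarrow> real^'n \<Rightarrow> real" where
  "partial i f x = frechet_derivative f (at x) (axis i 1)"

definition partials :: "'n list \<Rightarrow> (real^'n \<Rightarrow> real) \<Rightarrow> real^'n \<Rightarrow> real" where
  "partials is f = foldr partial is f"

primrec Ck :: "nat \<Rightarrow> (real^'n \<Rightarrow> real) \<Rightarrow> bool" where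
  "Ck 0 f \<longleftrightarrow> continuous_on UNIV f"
| "Ck (Suc k) f \<longleftrightarrow> (\<forall>x. f differentiable (at x)) \<and> (\<forall>i. Ck k (partial i f))"

definition test_functions :: "(real^'n) set \<Rightarrow> (real^'n \<Rightarrow> real) set" where
  "test_functions \<Omega> = {\<psi>. (\<forall>k. Ck k \<psi>) \<and>
     compact (closure {x. \<psi> x \<noteq> 0}) \<and> closure {x. \<psi> x \<noteq> 0} \<subseteq> \<Omega>}"

text \<open>Elements of Lebesgue and Sobolev spaces are represented by functions on the whole space,
  of which only the values on \<open>\<Omega>\<close> matter.\<close>

definition L2 :: "(real^'n) set \<Rightarrow> (real^'n \<Rightarrow> real) set" where
  "L2 \<Omega> = {f. f \<in> borel_measurable (lebesgue_on \<Omega>) \<and>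
     integrable (lebesgue_on \<Omega>) (\<lambda>x. (f x)\<^sup>2)}"

text \<open>The multi-index is given as the list of the directions of differentiation.
  The function \<open>g\<close> is determined up to a null set.\<close>

definition L2_weak_partial ::
    "(real^'n) set \<Rightarrow> 'n list \<Rightarrow> (real^'n \<Rightarrow> real) \<Rightarrow> (real^'n \<Rightarrow> real) \<Rightarrow> bool" where
  "L2_weak_partial \<Omega> is f g \<longleftrightarrow> g \<in> L2 \<Omega> \<and>
     (\<forall>\<psi>\<in>test_functions \<Omega>.
        (\<integral>x. f x * partials is \<psi> x \<partial>lebesgue_on \<Omega>) =
        (-1) ^ length is * (\<integral>x. g x * \<psi> x \<partial>lebesgue_on \<Omega>))"

definition sobolev_W2 :: "nat \<Rightarrow> (real^'n) set \<Rightarrow> (real^'n \<Rightarrow> real) set" where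
  "sobolev_W2 k \<Omega> = {f. f \<in> L2 \<Omega> \<and>
     (\<forall>is. length is \<le> k \<longrightarrow> (\<exists>g. L2_weak_partial \<Omega> is f g))}"

text \<open>\<open>H\<close> is a representative of the weak Hessian \<open>\<nabla>\<nabla>f\<close>. For \<open>f\<close> in \<open>W\<^sup>2\<^sup>,\<^sup>2\<close> the
  weak second derivatives are square integrable, so requiring this of \<open>H\<close> excludes nothing.\<close>

definition weak_hessian ::
    "(real^'n) set \<Rightarrow> (real^'n \<Rightarrow> real) \<Rightarrow> (real^'n \<Rightarrow> real^'n^'n) \<Rightarrow> bool" where
  "weak_hessian \<Omega> f H \<longleftrightarrow> (\<forall>i j. L2_weak_partial \<Omega> [i, j] f (\<lambda>x. H x $ i $ j))"


section \<open>Convex extensions and the dual problem\<close>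

definition convex_extensions :: "(real^2) set \<Rightarrow> (real^2 \<Rightarrow> real) set" where
  "convex_extensions \<Omega> = {\<phi>. convex_on UNIV \<phi> \<and> (\<forall>x. x \<notin> \<Omega> \<longrightarrow> \<phi> x = 1/2 * (norm x)\<^sup>2)}"

definition phi_plus :: "(real^2) set \<Rightarrow> real^2 \<Rightarrow> real" where
  "phi_plus \<Omega> x = (SUP \<phi>\<in>convex_extensions \<Omega>. \<phi> x)"

definition phi_minus :: "(real^2) set \<Rightarrow> real^2 \<Rightarrow> real" where
  "phi_minus \<Omega> x = (INF \<phi>\<in>convex_extensions \<Omega>. \<phi> x)"

text \<open>For bounded \<open>\<Omega>\<close> the real-valued supremum and infimum above are genuine: the sets of values
  are nonempty and bounded.\<close>

lemma convex_extensions_values_bounded: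
  assumes "bounded \<Omega>"
  shows "convex_extensions \<Omega> \<noteq> {}"
    and "bdd_above ((\<lambda>\<phi>. \<phi> x) ` convex_extensions \<Omega>)"
    and "bdd_below ((\<lambda>\<phi>. \<phi> x) ` convex_extensions \<Omega>)"
proof -
  have "convex_on UNIV (\<lambda>x::real^2. 1/2 * (norm x)\<^sup>2)"
  proof (rule convex_onI)
    fix t :: real and x y :: "real^2"
    assume t: "0 < t" "t < 1"
    have "(1 - t) * (norm x)\<^sup>2 + t * (norm y)\<^sup>2 - (norm ((1 - t) *\<^sub>R x + t *\<^sub>R y))\<^sup>2
        = t * (1 - t) * (norm (x - y))\<^sup>2"
      unfolding power2_norm_eq_inner
      by (simp add: inner_simps inner_commute algebra_simps)
    moreover have "0 \<le> t * (1 - t) * (norm (x - y))\<^sup>2"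
      using t by simp
    moreover have "(1 - t) * (1/2 * (norm x)\<^sup>2) + t * (1/2 * (norm y)\<^sup>2)
        = 1/2 * ((1 - t) * (norm x)\<^sup>2 + t * (norm y)\<^sup>2)"
      by (simp add: field_simps)
    ultimately show "1/2 * (norm ((1 - t) *\<^sub>R x + t *\<^sub>R y))\<^sup>2
        \<le> (1 - t) * (1/2 * (norm x)\<^sup>2) + t * (1/2 * (norm y)\<^sup>2)"
      by linarith
  qed simp
  then show "convex_extensions \<Omega> \<noteq> {}"
    unfolding convex_extensions_def by blast
  obtain B where B: "\<And>y. y \<in> \<Omega> \<Longrightarrow> norm y \<le> B"
    using assms by (auto simp: bounded_iff)
  define v :: "real^2" where "v = (norm x + \<bar>B\<bar> + 1) *\<^sub>R axis 1 1"
  have nv: "norm v = norm x + \<bar>B\<bar> + 1"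
    by (simp add: v_def)
  have out: "x + c *\<^sub>R v \<notin> \<Omega>" if "\<bar>c\<bar> \<ge> 1" for c
  proof
    assume "x + c *\<^sub>R v \<in> \<Omega>"
    then have "norm (x + c *\<^sub>R v) \<le> B" by (rule B)
    moreover have "norm (c *\<^sub>R v) - norm x \<le> norm (x + c *\<^sub>R v)"
      by (metis add.commute norm_diff_ineq)
    moreover have "norm v \<le> norm (c *\<^sub>R v)"
      using that by (simp add: mult_le_cancel_right1)
    ultimately show False using nv by linarith
  qed
  have mid: "\<phi> ((1/2) *\<^sub>R a + (1/2) *\<^sub>R b) \<le> 1/2 * \<phi> a + 1/2 * \<phi> b"
    if "\<phi> \<in> convex_extensions \<Omega>" for \<phi> a b
    using that convex_onD[of UNIV \<phi> "1/2" a b] by (simp add: convex_extensions_def)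
  let ?q = "\<lambda>y::real^2. 1/2 * (norm y)\<^sup>2"
  have val: "\<phi> (x + c *\<^sub>R v) = ?q (x + c *\<^sub>R v)"
    if "\<phi> \<in> convex_extensions \<Omega>" "\<bar>c\<bar> \<ge> 1" for \<phi> c
    using that out by (auto simp: convex_extensions_def)
  have e1: "(1/2) *\<^sub>R (x + 1 *\<^sub>R v) + (1/2) *\<^sub>R (x + (-1) *\<^sub>R v) = x"
    by (simp add: vec_eq_iff field_simps)
  have e2: "(1/2) *\<^sub>R x + (1/2) *\<^sub>R (x + 2 *\<^sub>R v) = x + 1 *\<^sub>R v"
    by (simp add: vec_eq_iff field_simps)
  show "bdd_above ((\<lambda>\<phi>. \<phi> x) ` convex_extensions \<Omega>)"
  proof (rule bdd_aboveI2)
    fix \<phi> assume \<phi>: "\<phi> \<in> convex_extensions \<Omega>"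
    show "\<phi> x \<le> 1/2 * ?q (x + 1 *\<^sub>R v) + 1/2 * ?q (x + (-1) *\<^sub>R v)"
      using mid[OF \<phi>, of "x + 1 *\<^sub>R v" "x + (-1) *\<^sub>R v"] val[OF \<phi>, of 1] val[OF \<phi>, of "-1"]
      unfolding e1 by simp
  qed
  show "bdd_below ((\<lambda>\<phi>. \<phi> x) ` convex_extensions \<Omega>)"
  proof (rule bdd_belowI2)
    fix \<phi> assume \<phi>: "\<phi> \<in> convex_extensions \<Omega>"
    show "2 * ?q (x + 1 *\<^sub>R v) - ?q (x + 2 *\<^sub>R v) \<le> \<phi> x"
      using mid[OF \<phi>, of x "x + 2 *\<^sub>R v"] val[OF \<phi>, of 1] val[OF \<phi>, of 2]
      unfolding e2 by simp
  qed
qed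

definition dual_integrand ::
    "(real^2 \<Rightarrow> real^2^2) \<Rightarrow> (real^2 \<Rightarrow> real) \<Rightarrow> real^2 \<Rightarrow> real" where
  "dual_integrand H \<phi> x = (\<phi> x - 1/2 * (norm x)\<^sup>2) * det (H x)"

text \<open>Integrability of all competitors is part of the definition, so that no value of the
  functional is the default value of a divergent integral.\<close>

definition solves_dual ::
    "(real^2) set \<Rightarrow> (real^2 \<Rightarrow> real^2^2) \<Rightarrow> (real^2 \<Rightarrow> real) \<Rightarrow> bool" where
  "solves_dual \<Omega> H \<phi> \<longleftrightarrow> \<phi> \<in> convex_extensions \<Omega> \<and>
     (\<forall>\<psi>\<in>convex_extensions \<Omega>.
        integrable (lebesgue_on \<Omega>) (dual_integrand H \<psi>) \<and>
        (\<integral>x. dual_integrand H \<psi> x \<partial>lebesgue_on \<Omega>)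
          \<le> (\<integral>x. dual_integrand H \<phi> x \<partial>lebesgue_on \<Omega>))"


section \<open>The minimization over boundary pairs and triples\<close>

definition is_minimum_of :: "real \<Rightarrow> real set \<Rightarrow> bool" where
  "is_minimum_of m S \<longleftrightarrow> m \<in> S \<and> (\<forall>s\<in>S. m \<le> s)"

definition boundary_combination_values :: "(real^2) set \<Rightarrow> real^2 \<Rightarrow> real set" where
  "boundary_combination_values \<Omega> x =
     {(\<Sum>y\<in>Y. \<theta> y * (1/2 * (norm y)\<^sup>2)) | Y \<theta>.
        Y \<subseteq> frontier \<Omega> \<and> (card Y = 2 \<or> card Y = 3) \<and>
        (\<forall>y\<in>Y. 0 < \<theta> y \<and> \<theta> y < 1) \<and> sum \<theta> Y = 1 \<and> (\<Sum>y\<in>Y. \<theta> y *\<^sub>R y) = x}"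

end

theory Submission
  imports Defs
begin

text \<open>Write \<open>q\<close> for the paraboloid \<open>half_sq\<close>, that is \<open>\<bar>x\<bar>\<^sup>2/2\<close>. Competitors in the dual problem differ from \<open>q\<close> by a bounded
  continuous function on \<open>\<Omega>\<close>, and \<open>det \<nabla>\<nabla>p\<close> is a sum of products of square integrable functions, so
  every competitor has a finite value. Where \<open>det \<nabla>\<nabla>p\<close> has a sign, the value is monotone
  in the competitor; hence the largest or smallest extension is optimal as soon as it is an
  extension. The work lies in identifying these two functions.

  The values of a convex extension are bounded above by Jensen's inequality at convex combinations of
  points of the complement of \<open>\<Omega>\<close>. The best such bound is the lower boundary of the convex hull of the
  graph of \<open>q\<close> over the complement (\<open>graph_hull\<close>). That lower boundary is itself a convex extension, so
  it equals \<open>\<phi>\<^sub>+\<close> (\<open>phi_plus_eq_Inf_graph_hull\<close>). Seen from \<open>x \<in> \<Omega>\<close>, a combination only gets cheaper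
  when each of its points is pulled along the ray from \<open>x\<close> to the boundary
  (\<open>graph_hull_push_to_frontier\<close>). Over the boundary, which is compact, the minimum is attained, and
  Caratheodory's argument reduces the minimizing combination to at most three points
  (\<open>graph_hull_caratheodory\<close>). One point alone does not occur, since \<open>x\<close> is not a boundary point.

  From below, a convex extension lies above its tangent planes. At interior points \<open>y\<close> of the
  complement the tangent plane is \<open>x \<mapsto> x \<bullet> y - q y\<close>, and since a Lipschitz domain lies on one side of
  its boundary, this persists for boundary points \<open>y\<close> (\<open>convex_extension_ge_tangent\<close>). Because
  \<open>x \<bullet> y - q y = q x - q (x - y)\<close>, the best of these bounds is attained at the point \<open>y\<close> nearest to \<open>x\<close>
  and is \<open>q x\<close> minus half the squared distance. This function is a supremum of affine functions and
  agrees with \<open>q\<close> off \<open>\<Omega>\<close>, so it is an extension and equals \<open>\<phi>\<^sub>-\<close>.\<close>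

section \<open>Convex hulls of graphs\<close>

text \<open>The points above \<open>x\<close> in this set record the values \<open>\<Sum>\<theta>\<^sub>i f(y\<^sub>i)\<close> of all convex combinations
  \<open>x = \<Sum>\<theta>\<^sub>i y\<^sub>i\<close> of points of \<open>S\<close>.\<close>

definition graph_hull :: "('a::real_vector \<Rightarrow> real) \<Rightarrow> 'a set \<Rightarrow> ('a \<times> real) set" where
  "graph_hull f S = convex hull ((\<lambda>y. (y, f y)) ` S)"

lemma graph_hull_sumI:
  assumes "finite I" "\<And>i. i \<in> I \<Longrightarrow> 0 \<le> c i" "sum c I = 1" "\<And>i. i \<in> I \<Longrightarrow> z i \<in> S"
  shows "(\<Sum>i\<in>I. c i *\<^sub>R z i, \<Sum>i\<in>I. c i * f (z i)) \<in> graph_hull f S"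
proof -
  have "(\<Sum>i\<in>I. c i *\<^sub>R (z i, f (z i))) \<in> graph_hull f S"
    unfolding graph_hull_def
    using assms by (intro convex_sum) (auto intro: hull_inc)
  moreover have "(\<Sum>i\<in>I. c i *\<^sub>R (z i, f (z i))) = (\<Sum>i\<in>I. c i *\<^sub>R z i, \<Sum>i\<in>I. c i * f (z i))"
    by (simp add: prod_eq_iff fst_sum snd_sum)
  ultimately show ?thesis by simp
qed

text \<open>Over distinct points of the graph the first coordinates are distinct, so a combination of graph
  points can be indexed by points of \<open>S\<close>. Points of weight zero are discarded.\<close>

lemma graph_hullE:
  assumes "(x, s) \<in> graph_hull f S"
  obtains Y \<theta> where "finite Y" "Y \<subseteq> S" "\<forall>y\<in>Y. 0 < \<theta> y" "sum \<theta> Y = 1"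
    "(\<Sum>y\<in>Y. \<theta> y *\<^sub>R y) = x" "(\<Sum>y\<in>Y. \<theta> y * f y) = s"
proof -
  let ?g = "\<lambda>y. (y, f y)"
  obtain T u where T: "finite T" "T \<subseteq> ?g ` S" "\<forall>v\<in>T. 0 \<le> u v" "sum u T = 1"
    and eq: "(\<Sum>v\<in>T. u v *\<^sub>R v) = (x, s)"
    using assms unfolding graph_hull_def convex_hull_explicit by blast
  define Y where "Y = {y\<in>fst ` T. u (?g y) \<noteq> 0}"
  define \<theta> where "\<theta> y = u (?g y)" for y
  have g: "?g (fst v) = v" if "v \<in> T" for v
    using T(2) that by auto
  have inj: "inj_on fst T"
    using g by (metis inj_onI)
  have red: "(\<Sum>y\<in>Y. h y) = (\<Sum>v\<in>T. h (fst v))"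
    if "\<And>y. u (?g y) = 0 \<Longrightarrow> h y = 0" for h :: "_ \<Rightarrow> 'b::comm_monoid_add"
  proof -
    have "(\<Sum>y\<in>Y. h y) = (\<Sum>y\<in>fst ` T. h y)"
      using T(1) that by (intro sum.mono_neutral_left) (auto simp: Y_def)
    also have "\<dots> = (\<Sum>v\<in>T. h (fst v))"
      using inj by (simp add: sum.reindex)
    finally show ?thesis .
  qed
  show thesis
  proof
    show "finite Y" using T(1) by (simp add: Y_def)
    show "Y \<subseteq> S" using T(2) by (auto simp: Y_def)
    show "\<forall>y\<in>Y. 0 < \<theta> y"
      using T(3) g by (force simp: Y_def \<theta>_def less_le)
    show "sum \<theta> Y = 1"
      using red[of \<theta>] T(4) g by (simp add: \<theta>_def)
    show "(\<Sum>y\<in>Y. \<theta> y *\<^sub>R y) = x"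
      using red[of "\<lambda>y. \<theta> y *\<^sub>R y"] arg_cong[OF eq, of fst] g by (simp add: \<theta>_def fst_sum)
    have "(\<Sum>y\<in>Y. \<theta> y * f y) = (\<Sum>v\<in>T. u v * snd v)"
      using red[of "\<lambda>y. \<theta> y * f y"] g
      by (auto simp: \<theta>_def intro!: sum.cong)
    then show "(\<Sum>y\<in>Y. \<theta> y * f y) = s"
      using arg_cong[OF eq, of snd] by (simp add: snd_sum)
  qed
qed

text \<open>The convex hull of a compact set in finite dimension is compact, hence so is its fibre over \<open>x\<close>.\<close>

lemma graph_hull_attains_min:
  fixes S :: "'a::euclidean_space set"
  assumes "compact S" "continuous_on S f" "(x, s) \<in> graph_hull f S"
  obtains m where "(x, m) \<in> graph_hull f S" "\<And>t. (x, t) \<in> graph_hull f S \<Longrightarrow> m \<le> t"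
proof -
  have "compact (graph_hull f S)"
    unfolding graph_hull_def using assms(1,2)
    by (intro compact_convex_hull compact_continuous_image continuous_intros)
  then have "compact (snd ` (graph_hull f S \<inter> ({x} \<times> UNIV)))"
    by (intro compact_continuous_image compact_Int_closed closed_Times continuous_intros) auto
  moreover have "snd ` (graph_hull f S \<inter> ({x} \<times> UNIV)) = {t. (x, t) \<in> graph_hull f S}"
    by force
  ultimately show thesis
    using compact_attains_inf[of "{t. (x, t) \<in> graph_hull f S}"] assms(3) that by auto
qed

text \<open>Caratheodory's theorem for the hull of the graph, which lives in one dimension more, would give
  \<open>DIM('a) + 2\<close> points. Allowing the cost to decrease saves one: in a combination with the fewest
  points, an affine dependence among the points would give a direction in which the weights can be moved
  without changing \<open>x\<close> and without increasing the cost, until one of them vanishes.\<close>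

lemma graph_hull_caratheodory:
  fixes S :: "'a::euclidean_space set"
  assumes "(x, s) \<in> graph_hull f S"
  obtains Y \<theta> where "finite Y" "card Y \<le> DIM('a) + 1" "Y \<subseteq> S" "\<forall>y\<in>Y. 0 < \<theta> y"
    "sum \<theta> Y = 1" "(\<Sum>y\<in>Y. \<theta> y *\<^sub>R y) = x" "(\<Sum>y\<in>Y. \<theta> y * f y) \<le> s"
proof -
  define P where "P Y \<theta> \<longleftrightarrow> finite Y \<and> Y \<subseteq> S \<and> (\<forall>y\<in>Y. 0 < \<theta> y) \<and> sum \<theta> Y = 1 \<and>
    (\<Sum>y\<in>Y. \<theta> y *\<^sub>R y) = x \<and> (\<Sum>y\<in>Y. \<theta> y * f y) \<le> s" for Y \<theta>
  define N where "N n \<longleftrightarrow> (\<exists>Y \<theta>. P Y \<theta> \<and> card Y = n)" for n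
  obtain Y\<^sub>0 \<theta>\<^sub>0 where "finite Y\<^sub>0" "Y\<^sub>0 \<subseteq> S" "\<forall>y\<in>Y\<^sub>0. 0 < \<theta>\<^sub>0 y" "sum \<theta>\<^sub>0 Y\<^sub>0 = 1"
    "(\<Sum>y\<in>Y\<^sub>0. \<theta>\<^sub>0 y *\<^sub>R y) = x" "(\<Sum>y\<in>Y\<^sub>0. \<theta>\<^sub>0 y * f y) = s"
    using assms by (rule graph_hullE)
  then have "P Y\<^sub>0 \<theta>\<^sub>0"
    by (simp add: P_def)
  then have "\<exists>n. N n"
    by (auto simp: N_def)
  then have "N (LEAST n. N n)"
    by (rule LeastI_ex)
  then obtain Y \<theta> where P: "P Y \<theta>" and "card Y = (LEAST n. N n)"
    unfolding N_def by blast
  then have least: "card Y \<le> card Y'" if "P Y' \<theta>'" for Y' \<theta>'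
    using that Least_le[of N "card Y'"] unfolding N_def by auto
  from P have fin: "finite Y" and pos: "\<And>y. y \<in> Y \<Longrightarrow> 0 < \<theta> y"
    by (auto simp: P_def)
  have "card Y \<le> DIM('a) + 1"
  proof (rule ccontr)
    assume "\<not> ?thesis"
    then have "affine_dependent Y"
      using fin by (intro affine_dependent_biggerset) auto
    then obtain c0 where c0: "sum c0 Y = 0" "\<exists>v\<in>Y. c0 v \<noteq> 0" "(\<Sum>v\<in>Y. c0 v *\<^sub>R v) = 0"
      using affine_dependent_explicit_finite[OF fin] by auto
    \<comment> \<open>Of the two directions \<open>c0\<close> and \<open>- c0\<close>, one does not increase the cost.\<close>
    obtain c where c: "sum c Y = 0" "\<exists>v\<in>Y. c v \<noteq> 0" "(\<Sum>v\<in>Y. c v *\<^sub>R v) = 0"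
      and cost: "(\<Sum>v\<in>Y. c v * f v) \<le> 0"
    proof (cases "(\<Sum>v\<in>Y. c0 v * f v) \<le> 0")
      case True
      with c0 that show thesis by blast
    next
      case False
      with c0 that[of "\<lambda>v. - c0 v"] show thesis by (simp add: sum_negf)
    qed
    have "\<exists>v\<in>Y. c v < 0"
    proof (rule ccontr)
      assume "\<not> ?thesis"
      then have "\<forall>v\<in>Y. c v = 0"
        using sum_nonneg_eq_0_iff[OF fin, of c] c(1) by (auto simp: not_less)
      with c(2) show False by blast
    qed
    then have ne: "{v\<in>Y. c v < 0} \<noteq> {}" by blast
    \<comment> \<open>The first time at which a weight \<open>\<theta> v + t * c v\<close> vanishes.\<close>
    define t where "t = Min ((\<lambda>v. \<theta> v / - c v) ` {v\<in>Y. c v < 0})"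
    have "t \<in> (\<lambda>v. \<theta> v / - c v) ` {v\<in>Y. c v < 0}"
      unfolding t_def using fin ne by (intro Min_in) auto
    then obtain w where w: "w \<in> Y" "c w < 0" "t = \<theta> w / - c w" by blast
    have "t > 0" using w pos[of w] by (simp add: divide_pos_neg)
    define \<eta> where "\<eta> v = \<theta> v + t * c v" for v
    have \<eta>_nonneg: "0 \<le> \<eta> v" if "v \<in> Y" for v
    proof (cases "c v < 0")
      case True
      with that fin have "t \<le> \<theta> v / - c v"
        unfolding t_def by (intro Min_le) auto
      with True show ?thesis by (simp add: \<eta>_def field_simps)
    next
      case False
      with \<open>t > 0\<close> pos[OF that] show ?thesis by (simp add: \<eta>_def)
    qed
    have "\<eta> w = 0" using w by (simp add: \<eta>_def)
    define Y' where "Y' = {v\<in>Y. \<eta> v \<noteq> 0}"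
    have red: "(\<Sum>v\<in>Y'. h v) = (\<Sum>v\<in>Y. h v)" if "\<And>v. \<eta> v = 0 \<Longrightarrow> h v = 0"
      for h :: "'a \<Rightarrow> 'b::comm_monoid_add"
      using fin that by (intro sum.mono_neutral_left) (auto simp: Y'_def)
    have "P Y' \<eta>"
      unfolding P_def
    proof (intro conjI ballI)
      show "finite Y'" "Y' \<subseteq> S" using P by (auto simp: P_def Y'_def)
      show "0 < \<eta> y" if "y \<in> Y'" for y
        using that \<eta>_nonneg[of y] by (simp add: Y'_def less_le)
      have "sum \<eta> Y' = sum \<eta> Y"
        by (rule red)
      also have "\<dots> = sum \<theta> Y + t * sum c Y"
        by (simp add: \<eta>_def sum.distrib sum_distrib_left)
      finally show "sum \<eta> Y' = 1"
        using P c(1) by (simp add: P_def)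
      have "(\<Sum>y\<in>Y'. \<eta> y *\<^sub>R y) = (\<Sum>y\<in>Y. \<eta> y *\<^sub>R y)"
        by (rule red) simp
      also have "\<dots> = (\<Sum>y\<in>Y. \<theta> y *\<^sub>R y) + t *\<^sub>R (\<Sum>y\<in>Y. c y *\<^sub>R y)"
        by (simp add: \<eta>_def scaleR_add_left sum.distrib scaleR_sum_right)
      finally show "(\<Sum>y\<in>Y'. \<eta> y *\<^sub>R y) = x"
        using P c(3) by (simp add: P_def)
      have "(\<Sum>y\<in>Y'. \<eta> y * f y) = (\<Sum>y\<in>Y. \<eta> y * f y)"
        by (rule red) simp
      also have "\<dots> = (\<Sum>y\<in>Y. \<theta> y * f y) + t * (\<Sum>y\<in>Y. c y * f y)"
        by (simp add: \<eta>_def distrib_right sum.distrib sum_distrib_left mult.assoc)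
      also have "\<dots> \<le> (\<Sum>y\<in>Y. \<theta> y * f y)"
        using mult_nonneg_nonpos[OF less_imp_le[OF \<open>t > 0\<close>] cost] by simp
      also have "\<dots> \<le> s"
        using P by (simp add: P_def)
      finally show "(\<Sum>y\<in>Y'. \<eta> y * f y) \<le> s" .
    qed
    moreover have "card Y' < card Y"
      using fin w(1) \<open>\<eta> w = 0\<close> by (intro psubset_card_mono) (auto simp: Y'_def)
    ultimately show False
      using least[of Y' \<eta>] by linarith
  qed
  with P show thesis
    by (intro that[of Y \<theta>]) (simp_all add: P_def)
qed

section \<open>The paraboloid over the complement of a bounded open set\<close>

abbreviation half_sq :: "'a::real_inner \<Rightarrow> real" where
  "half_sq x \<equiv> 1/2 * (norm x)\<^sup>2"

text \<open>The gap between \<open>q\<close> and its tangent plane at \<open>y\<close> is \<open>q (x - y)\<close>. This is what turns the best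
  tangent plane below \<open>x\<close> into a nearest point problem.\<close>

lemma half_sq_tangent: "half_sq x - half_sq (x - y) = x \<bullet> y - half_sq y"
  unfolding power2_norm_eq_inner by (simp add: inner_simps inner_commute algebra_simps)

text \<open>The variance identity: the cost of a combination exceeds \<open>q x\<close> by the mean of the half squared
  distances to the barycentre \<open>x\<close>.\<close>

lemma half_sq_combination:
  fixes y :: "'i \<Rightarrow> 'a::real_inner"
  assumes "sum c I = 1" "(\<Sum>i\<in>I. c i *\<^sub>R y i) = x"
  shows "(\<Sum>i\<in>I. c i * half_sq (y i)) = half_sq x + (\<Sum>i\<in>I. c i * half_sq (x - y i))"
proof -
  have "(\<Sum>i\<in>I. c i * half_sq (x - y i)) - (\<Sum>i\<in>I. c i * half_sq (y i))
      = (\<Sum>i\<in>I. c i * (half_sq (x - y i) - half_sq (y i)))"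
    by (simp add: sum_subtractf right_diff_distrib)
  also have "\<dots> = (\<Sum>i\<in>I. c i * half_sq x - x \<bullet> (c i *\<^sub>R y i))"
  proof (rule sum.cong[OF refl])
    fix i
    have "half_sq (x - y i) - half_sq (y i) = half_sq x - x \<bullet> y i"
      using half_sq_tangent[of x "y i"] by linarith
    then show "c i * (half_sq (x - y i) - half_sq (y i)) = c i * half_sq x - x \<bullet> (c i *\<^sub>R y i)"
      by (simp add: right_diff_distrib)
  qed
  also have "\<dots> = sum c I * half_sq x - x \<bullet> (\<Sum>i\<in>I. c i *\<^sub>R y i)"
    by (simp only: sum_subtractf sum_distrib_right inner_sum_right)
  also have "\<dots> = - half_sq x"
    by (simp only: assms power2_norm_eq_inner)
  finally show ?thesis by linarith
qed

lemma half_sq_le_graph_hull: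
  fixes S :: "'a::real_inner set"
  assumes "(x, s) \<in> graph_hull half_sq S"
  shows "half_sq x \<le> s"
proof -
  obtain Y \<theta> where Y: "finite Y" "Y \<subseteq> S" "\<forall>y\<in>Y. 0 < \<theta> y" "sum \<theta> Y = 1"
    "(\<Sum>y\<in>Y. \<theta> y *\<^sub>R y) = x" "(\<Sum>y\<in>Y. \<theta> y * half_sq y) = s"
    using assms by (rule graph_hullE)
  have "0 \<le> (\<Sum>y\<in>Y. \<theta> y * half_sq (x - y))"
    using Y(3) by (intro sum_nonneg mult_nonneg_nonneg) (auto simp: less_imp_le)
  then show ?thesis
    using half_sq_combination[OF Y(4,5)] Y(6) by linarith
qed

text \<open>Far enough away, two points symmetric about \<open>x\<close> avoid the bounded set.\<close>

lemma graph_hull_complement_nonempty: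
  fixes \<Omega> :: "'a::euclidean_space set"
  assumes "bounded \<Omega>"
  shows "\<exists>s. (x, s) \<in> graph_hull f (- \<Omega>)"
proof -
  have "bounded ((\<lambda>y. y - x) ` \<Omega>)" "bounded ((\<lambda>y. x - y) ` \<Omega>)"
    using assms bounded_minus_comp[of "\<lambda>y. y" \<Omega> "\<lambda>_. x"] bounded_minus_comp[of "\<lambda>_. x" \<Omega> "\<lambda>y. y"]
    by (simp_all add: image_constant_conv)
  then have "bounded ((\<lambda>y. y - x) ` \<Omega> \<union> (\<lambda>y. x - y) ` \<Omega>)"
    by simp
  then obtain v where v: "v \<notin> (\<lambda>y. y - x) ` \<Omega> \<union> (\<lambda>y. x - y) ` \<Omega>"
    using not_bounded_UNIV by (metis UNIV_eq_I)
  have "x + v \<in> - \<Omega>" "x - v \<in> - \<Omega>"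
    using v by (force simp: image_iff)+
  then have "(\<Sum>i\<in>{True, False}. (1/2) *\<^sub>R (if i then x + v else x - v),
      \<Sum>i\<in>{True, False}. 1/2 * f (if i then x + v else x - v)) \<in> graph_hull f (- \<Omega>)"
    by (intro graph_hull_sumI) auto
  moreover have "(\<Sum>i\<in>{True, False}. (1/2) *\<^sub>R (if i then x + v else x - v)) = x"
    by (simp add: scaleR_add_right scaleR_diff_right flip: scaleR_add_left)
  ultimately show ?thesis by metis
qed

lemma frontier_on_segment:
  fixes \<Omega> :: "'a::real_normed_vector set"
  assumes "open \<Omega>" "x \<in> \<Omega>" "y \<notin> \<Omega>"
  obtains s where "0 < s" "s \<le> 1" "x + s *\<^sub>R (y - x) \<in> frontier \<Omega>"
proof -
  have "closed_segment x y \<inter> frontier \<Omega> \<noteq> {}"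
    using assms by (intro connected_Int_frontier) auto
  then obtain s where s: "0 \<le> s" "s \<le> 1" "(1 - s) *\<^sub>R x + s *\<^sub>R y \<in> frontier \<Omega>"
    by (auto simp: in_segment)
  moreover have "(1 - s) *\<^sub>R x + s *\<^sub>R y = x + s *\<^sub>R (y - x)"
    by (simp add: algebra_simps)
  moreover have "s \<noteq> 0"
    using s(3) assms(1,2) by (auto simp: frontier_def interior_open)
  ultimately show thesis
    using that[of s] by auto
qed

text \<open>Replace each point \<open>y\<close> by a boundary point \<open>z\<^sub>y = x + s\<^sub>y (y - x)\<close> with \<open>0 < s\<^sub>y \<le> 1\<close>. The point \<open>x\<close> is
  still the barycentre for weights proportional to \<open>\<theta>\<^sub>y / s\<^sub>y\<close>, and the normalizing constant
  \<open>K = \<Sum>\<theta>\<^sub>y / s\<^sub>y\<close> is at least 1. By the variance identity the excess cost of the new combination is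
  \<open>\<Sum>(\<theta>\<^sub>y s\<^sub>y / K) q (x - y)\<close>, which is no more than the old one. Distinct \<open>y\<close> on one ray may share
  the same \<open>z\<^sub>y\<close>; hence the combination is kept indexed by \<open>y\<close>.\<close>

lemma graph_hull_push_to_frontier:
  fixes \<Omega> :: "'a::real_inner set"
  assumes "open \<Omega>" "x \<in> \<Omega>" "(x, t) \<in> graph_hull half_sq (- \<Omega>)"
  obtains t' where "t' \<le> t" "(x, t') \<in> graph_hull half_sq (frontier \<Omega>)"
proof -
  obtain Y \<theta> where Y: "finite Y" "Y \<subseteq> - \<Omega>" "\<forall>y\<in>Y. 0 < \<theta> y" "sum \<theta> Y = 1"
    "(\<Sum>y\<in>Y. \<theta> y *\<^sub>R y) = x" "(\<Sum>y\<in>Y. \<theta> y * half_sq y) = t"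
    using assms(3) by (rule graph_hullE)
  have "\<forall>y\<in>Y. \<exists>s. 0 < s \<and> s \<le> 1 \<and> x + s *\<^sub>R (y - x) \<in> frontier \<Omega>"
  proof
    fix y assume "y \<in> Y"
    with Y(2) have "y \<notin> \<Omega>" by blast
    then show "\<exists>s. 0 < s \<and> s \<le> 1 \<and> x + s *\<^sub>R (y - x) \<in> frontier \<Omega>"
      using frontier_on_segment[OF assms(1,2)] by blast
  qed
  then obtain s where s: "\<And>y. y \<in> Y \<Longrightarrow> 0 < s y" "\<And>y. y \<in> Y \<Longrightarrow> s y \<le> 1"
    "\<And>y. y \<in> Y \<Longrightarrow> x + s y *\<^sub>R (y - x) \<in> frontier \<Omega>"
    by metis
  define z where "z y = x + s y *\<^sub>R (y - x)" for y
  define K where "K = (\<Sum>y\<in>Y. \<theta> y / s y)"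
  define c where "c y = \<theta> y / s y / K" for y
  have "1 \<le> K"
    unfolding K_def Y(4)[symmetric] using s Y(3)
    by (intro sum_mono) (simp add: pos_le_divide_eq mult_left_le less_imp_le)
  have c: "0 \<le> c y" if "y \<in> Y" for y
    using that s(1) Y(3) \<open>1 \<le> K\<close> by (simp add: c_def less_imp_le)
  have c1: "sum c Y = 1"
  proof -
    have "sum c Y = K / K"
      unfolding c_def by (simp only: sum_divide_distrib[symmetric] K_def[symmetric])
    with \<open>1 \<le> K\<close> show ?thesis by simp
  qed
  have cs: "c y * s y = \<theta> y / K" if "y \<in> Y" for y
    using s(1)[OF that] by (simp add: c_def)
  have "(\<Sum>y\<in>Y. c y *\<^sub>R z y) = (\<Sum>y\<in>Y. c y *\<^sub>R x + (\<theta> y / K) *\<^sub>R (y - x))"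
    by (intro sum.cong) (simp_all add: z_def scaleR_add_right cs)
  also have "\<dots> = x + (1 / K) *\<^sub>R (\<Sum>y\<in>Y. \<theta> y *\<^sub>R (y - x))"
    by (simp add: sum.distrib c1 scaleR_sum_right flip: scaleR_sum_left)
  also have "(\<Sum>y\<in>Y. \<theta> y *\<^sub>R (y - x)) = 0"
    by (simp add: scaleR_diff_right sum_subtractf Y(4,5) flip: scaleR_sum_left)
  finally have cz: "(\<Sum>y\<in>Y. c y *\<^sub>R z y) = x" by simp
  have "(x, \<Sum>y\<in>Y. c y * half_sq (z y)) \<in> graph_hull half_sq (frontier \<Omega>)"
    using graph_hull_sumI[of Y c z "frontier \<Omega>" half_sq] Y(1) c c1 s(3) cz by (simp add: z_def)
  moreover have "(\<Sum>y\<in>Y. c y * half_sq (z y)) \<le> t"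
  proof -
    have "c y * half_sq (x - z y) \<le> \<theta> y * half_sq (x - y)" if y: "y \<in> Y" for y
    proof -
      have "norm (x - z y) = s y * norm (x - y)"
        using s(1)[OF y] by (simp add: z_def norm_minus_commute)
      then have "c y * half_sq (x - z y) = (\<theta> y / K * s y) * half_sq (x - y)"
        using cs[OF y] by (simp add: power_mult_distrib power2_eq_square flip: cs[OF y])
      also have "\<dots> \<le> \<theta> y * half_sq (x - y)"
      proof (rule mult_right_mono)
        have "s y \<le> K" using s(2)[OF y] \<open>1 \<le> K\<close> by linarith
        then show "\<theta> y / K * s y \<le> \<theta> y"
          using Y(3)[rule_format, OF y] \<open>1 \<le> K\<close> by (simp add: pos_divide_le_eq)
      qed simp
      finally show ?thesis .
    qed
    then have "(\<Sum>y\<in>Y. c y * half_sq (x - z y)) \<le> (\<Sum>y\<in>Y. \<theta> y * half_sq (x - y))"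
      by (rule sum_mono)
    then show ?thesis
      using half_sq_combination[OF c1 cz] half_sq_combination[OF Y(4,5)] Y(6) by linarith
  qed
  ultimately show thesis using that by blast
qed

section \<open>The largest convex extension\<close>

lemma convex_extension_le_graph_hull:
  assumes "\<phi> \<in> convex_extensions \<Omega>" "(x, s) \<in> graph_hull half_sq (- \<Omega>)"
  shows "\<phi> x \<le> s"
proof -
  obtain Y \<theta> where Y: "finite Y" "Y \<subseteq> - \<Omega>" "\<forall>y\<in>Y. 0 < \<theta> y" "sum \<theta> Y = 1"
    "(\<Sum>y\<in>Y. \<theta> y *\<^sub>R y) = x" "(\<Sum>y\<in>Y. \<theta> y * half_sq y) = s"
    using assms(2) by (rule graph_hullE)
  have "\<phi> (\<Sum>y\<in>Y. \<theta> y *\<^sub>R y) \<le> (\<Sum>y\<in>Y. \<theta> y * \<phi> y)"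
    using assms(1) Y by (intro convex_on_sum[of _ UNIV]) (auto simp: convex_extensions_def less_imp_le)
  also have "\<dots> = s"
    unfolding Y(6)[symmetric] using assms(1) Y(2)
    by (intro sum.cong) (auto simp: convex_extensions_def)
  finally show ?thesis using Y(5) by simp
qed

text \<open>The fibrewise infimum of a convex set is a convex function. Off \<open>\<Omega>\<close> the one-point combination has
  cost \<open>q x\<close>, and by convexity of \<open>q\<close> no combination is cheaper.\<close>

lemma lower_envelope_in_convex_extensions:
  assumes "bounded \<Omega>"
  shows "(\<lambda>x. Inf {s. (x, s) \<in> graph_hull half_sq (- \<Omega>)}) \<in> convex_extensions \<Omega>" (is "?\<Psi> \<in> _")
proof -
  have ne: "{s. (x, s) \<in> graph_hull half_sq (- \<Omega>)} \<noteq> {}" for x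
    using graph_hull_complement_nonempty[OF assms] by blast
  have bdd: "bdd_below {s. (x, s) \<in> graph_hull half_sq (- \<Omega>)}" for x
    using half_sq_le_graph_hull[of x _ "- \<Omega>"] by (intro bdd_belowI[of _ "half_sq x"]) simp
  have "convex_on UNIV ?\<Psi>"
  proof (rule convex_onI)
    fix t :: real and x y :: "real^2"
    assume t: "0 < t" "t < 1"
    show "?\<Psi> ((1 - t) *\<^sub>R x + t *\<^sub>R y) \<le> (1 - t) * ?\<Psi> x + t * ?\<Psi> y"
    proof (rule field_le_epsilon)
      fix e :: real assume "e > 0"
      obtain a where a: "(x, a) \<in> graph_hull half_sq (- \<Omega>)" "a < ?\<Psi> x + e"
        using cInf_lessD[OF ne, of x "?\<Psi> x + e"] \<open>e > 0\<close> by auto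
      obtain b where b: "(y, b) \<in> graph_hull half_sq (- \<Omega>)" "b < ?\<Psi> y + e"
        using cInf_lessD[OF ne, of y "?\<Psi> y + e"] \<open>e > 0\<close> by auto
      have "(1 - t) *\<^sub>R (x, a) + t *\<^sub>R (y, b) \<in> graph_hull half_sq (- \<Omega>)"
        using convex_convex_hull a(1) b(1) t unfolding graph_hull_def
        by (intro convexD) auto
      then have "?\<Psi> ((1 - t) *\<^sub>R x + t *\<^sub>R y) \<le> (1 - t) * a + t * b"
        using bdd by (intro cInf_lower) auto
      also have "\<dots> \<le> (1 - t) * (?\<Psi> x + e) + t * (?\<Psi> y + e)"
        using a(2) b(2) t by (intro add_mono mult_left_mono) auto
      finally show "?\<Psi> ((1 - t) *\<^sub>R x + t *\<^sub>R y) \<le> (1 - t) * ?\<Psi> x + t * ?\<Psi> y + e"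
        by (simp add: algebra_simps)
    qed
  qed simp
  moreover have "?\<Psi> x = half_sq x" if "x \<notin> \<Omega>" for x
  proof (rule cInf_eq_minimum)
    show "half_sq x \<in> {s. (x, s) \<in> graph_hull half_sq (- \<Omega>)}"
      using that by (auto simp: graph_hull_def intro: hull_inc)
  qed (use half_sq_le_graph_hull in auto)
  ultimately show ?thesis by (simp add: convex_extensions_def)
qed

lemma le_phi_plus:
  assumes "bounded \<Omega>" "\<phi> \<in> convex_extensions \<Omega>"
  shows "\<phi> x \<le> phi_plus \<Omega> x"
  unfolding phi_plus_def
  using assms by (intro cSUP_upper convex_extensions_values_bounded)

lemma phi_plus_eq_Inf_graph_hull:
  assumes "bounded \<Omega>"
  shows "phi_plus \<Omega> x = Inf {s. (x, s) \<in> graph_hull half_sq (- \<Omega>)}"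
proof (rule antisym)
  show "phi_plus \<Omega> x \<le> Inf {s. (x, s) \<in> graph_hull half_sq (- \<Omega>)}"
    unfolding phi_plus_def
    using convex_extensions_values_bounded(1)[OF assms] graph_hull_complement_nonempty[OF assms]
    by (intro cSUP_least cInf_greatest) (auto intro: convex_extension_le_graph_hull)
  show "Inf {s. (x, s) \<in> graph_hull half_sq (- \<Omega>)} \<le> phi_plus \<Omega> x"
    using le_phi_plus[OF assms lower_envelope_in_convex_extensions[OF assms]] .
qed

lemma phi_plus_in_convex_extensions:
  assumes "bounded \<Omega>"
  shows "phi_plus \<Omega> \<in> convex_extensions \<Omega>"
  using lower_envelope_in_convex_extensions[OF assms]
  by (simp add: phi_plus_eq_Inf_graph_hull[OF assms, abs_def])

lemma frontier_open_subset: "open \<Omega> \<Longrightarrow> frontier \<Omega> \<subseteq> - \<Omega>"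
  by (auto simp: frontier_def interior_open)

text \<open>Since pushing to the boundary does not raise the cost, the infimum over the complement is the
  minimum over the boundary, and this minimum is attained by a combination of at most three points.\<close>

lemma phi_plus_is_minimum:
  assumes "bounded \<Omega>" "open \<Omega>" "x \<in> \<Omega>"
  shows "is_minimum_of (phi_plus \<Omega> x) (boundary_combination_values \<Omega> x)"
proof -
  let ?F = "graph_hull half_sq (frontier \<Omega>)" and ?C = "graph_hull half_sq (- \<Omega>)"
  have sub: "?F \<subseteq> ?C"
    unfolding graph_hull_def using frontier_open_subset[OF assms(2)]
    by (intro hull_mono image_mono)
  obtain s0 where "(x, s0) \<in> ?C"
    using graph_hull_complement_nonempty[OF assms(1)] by blast
  then obtain s1 where "(x, s1) \<in> ?F"
    using graph_hull_push_to_frontier[OF assms(2,3)] by blast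
  moreover have "compact (frontier \<Omega>)"
    using assms(1) by (rule compact_frontier_bounded)
  ultimately obtain m where m: "(x, m) \<in> ?F" and min: "\<And>t. (x, t) \<in> ?F \<Longrightarrow> m \<le> t"
    by (rule_tac graph_hull_attains_min[of "frontier \<Omega>" half_sq x s1]) (auto intro!: continuous_intros)
  have below: "phi_plus \<Omega> x \<le> t" if "(x, t) \<in> ?F" for t
    using convex_extension_le_graph_hull[OF phi_plus_in_convex_extensions[OF assms(1)]] that sub
    by blast
  have eq: "phi_plus \<Omega> x = m"
  proof (rule antisym)
    show "m \<le> phi_plus \<Omega> x"
      unfolding phi_plus_eq_Inf_graph_hull[OF assms(1)]
    proof (rule cInf_greatest)
      fix t assume "t \<in> {s. (x, s) \<in> ?C}"
      then obtain t' where "t' \<le> t" "(x, t') \<in> ?F"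
        using graph_hull_push_to_frontier[OF assms(2,3)] by blast
      with min show "m \<le> t" by fastforce
    qed (use \<open>(x, s0) \<in> ?C\<close> in blast)
  qed (rule below[OF m])
  obtain Y \<theta> where Y: "finite Y" "card Y \<le> DIM(real^2) + 1" "Y \<subseteq> frontier \<Omega>"
    "\<forall>y\<in>Y. 0 < \<theta> y" "sum \<theta> Y = 1" "(\<Sum>y\<in>Y. \<theta> y *\<^sub>R y) = x"
    "(\<Sum>y\<in>Y. \<theta> y * half_sq y) \<le> m"
    using m by (rule graph_hull_caratheodory)
  have "card Y \<noteq> 0" using Y(1,5) by auto
  moreover have "card Y \<noteq> 1"
  proof
    assume "card Y = 1"
    then obtain y where "Y = {y}" by (auto simp: card_1_singleton_iff)
    with Y(3,5,6) frontier_open_subset[OF assms(2)] assms(3) show False by auto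
  qed
  ultimately have card: "card Y = 2 \<or> card Y = 3" using Y(2) by simp linarith
  have lt1: "\<theta> y < 1" if "y \<in> Y" for y
  proof -
    have "Y - {y} \<noteq> {}"
      using card that Y(1) by (metis \<open>card Y \<noteq> 1\<close> card_1_singleton_iff Diff_eq_empty_iff One_nat_def
        subset_singletonD empty_iff)
    then have "0 < sum \<theta> (Y - {y})"
      using Y(1,4) by (intro sum_pos) auto
    then show ?thesis
      using Y(5) sum.remove[OF Y(1) that, of \<theta>] by linarith
  qed
  have "(x, \<Sum>y\<in>Y. \<theta> y * half_sq y) \<in> ?F"
    using graph_hull_sumI[of Y \<theta> "\<lambda>y. y" "frontier \<Omega>" half_sq] Y by (auto simp: less_imp_le)
  then have "(\<Sum>y\<in>Y. \<theta> y * half_sq y) = phi_plus \<Omega> x"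
    using Y(7) min eq by fastforce
  then have "phi_plus \<Omega> x \<in> boundary_combination_values \<Omega> x"
    unfolding boundary_combination_values_def mem_Collect_eq
    using Y(3,4,5,6) card lt1 by (intro exI[of _ Y] exI[of _ \<theta>]) auto
  moreover have "phi_plus \<Omega> x \<le> s" if s: "s \<in> boundary_combination_values \<Omega> x" for s
  proof -
    obtain Z \<eta> where Z: "s = (\<Sum>y\<in>Z. \<eta> y * half_sq y)" "Z \<subseteq> frontier \<Omega>" "card Z = 2 \<or> card Z = 3"
      "\<forall>y\<in>Z. 0 < \<eta> y \<and> \<eta> y < 1" "sum \<eta> Z = 1" "(\<Sum>y\<in>Z. \<eta> y *\<^sub>R y) = x"
      using s unfolding boundary_combination_values_def mem_Collect_eq by (elim exE conjE) (rule that)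
    have "finite Z" using Z(3) by (auto intro: card_ge_0_finite)
    then have "(x, s) \<in> ?F"
      using graph_hull_sumI[of Z \<eta> "\<lambda>y. y" "frontier \<Omega>" half_sq] Z by (auto simp: less_imp_le)
    then show ?thesis by (rule below)
  qed
  ultimately show ?thesis by (simp add: is_minimum_of_def)
qed

section \<open>The smallest convex extension\<close>

text \<open>Near \<open>y\<close> the extension is the smooth function \<open>q\<close>, whose gradient at \<open>y\<close> is \<open>y\<close>. Comparing with
  one point \<open>y + t (x - y)\<close> close to \<open>y\<close> already suffices, since \<open>q\<close> lies above its tangent plane.\<close>

lemma convex_extension_ge_tangent_interior:
  assumes "\<phi> \<in> convex_extensions \<Omega>" "y \<in> interior (- \<Omega>)"
  shows "x \<bullet> y - half_sq y \<le> \<phi> x"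
proof -
  have "((\<lambda>t. y + t *\<^sub>R (x - y)) \<longlongrightarrow> y + 0 *\<^sub>R (x - y)) (at_right 0)"
    by (intro tendsto_intros)
  then have "eventually (\<lambda>t. y + t *\<^sub>R (x - y) \<in> interior (- \<Omega>)) (at_right 0)"
    using assms(2) by (intro topological_tendstoD) auto
  moreover have "eventually (\<lambda>t. 0 < t \<and> t < (1::real)) (at_right 0)"
    by (simp add: eventually_at_right_field) (meson zero_less_one)
  ultimately have "eventually (\<lambda>t. y + t *\<^sub>R (x - y) \<in> interior (- \<Omega>) \<and> 0 < t \<and> t < 1) (at_right 0)"
    by (rule eventually_conj)
  then obtain t where t: "y + t *\<^sub>R (x - y) \<in> interior (- \<Omega>)" "0 < t" "t < 1"
    using eventually_happens'[OF trivial_limit_at_right_real] by blast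
  have "\<phi> ((1 - t) *\<^sub>R y + t *\<^sub>R x) \<le> (1 - t) * \<phi> y + t * \<phi> x"
    using assms(1) t by (intro convex_onD[of UNIV]) (auto simp: convex_extensions_def)
  moreover have "(1 - t) *\<^sub>R y + t *\<^sub>R x = y + t *\<^sub>R (x - y)"
    by (simp add: algebra_simps)
  moreover have "\<phi> (y + t *\<^sub>R (x - y)) = half_sq (y + t *\<^sub>R (x - y))" "\<phi> y = half_sq y"
    using assms t(1) interior_subset[of "- \<Omega>"] by (auto simp: convex_extensions_def)
  ultimately have "half_sq (y + t *\<^sub>R (x - y)) \<le> (1 - t) * half_sq y + t * \<phi> x"
    by metis
  moreover have "half_sq (y + t *\<^sub>R (x - y)) = half_sq y + t * (y \<bullet> (x - y)) + t\<^sup>2 * half_sq (x - y)"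
    unfolding power2_norm_eq_inner
    by (simp add: inner_simps inner_commute power2_eq_square algebra_simps)
  moreover have "0 \<le> t\<^sup>2 * half_sq (x - y)" by simp
  ultimately have "t * (half_sq y + y \<bullet> (x - y)) \<le> t * \<phi> x"
    unfolding distrib_left left_diff_distrib by linarith
  then have "half_sq y + y \<bullet> (x - y) \<le> \<phi> x"
    using t(2) by simp
  moreover have "half_sq y + y \<bullet> (x - y) = x \<bullet> y - half_sq y"
    unfolding power2_norm_eq_inner by (simp add: inner_simps inner_commute)
  ultimately show ?thesis by simp
qed

text \<open>Going straight down from a boundary point in the local coordinates leads into the open set below
  the Lipschitz graph, which is disjoint from \<open>\<Omega>\<close>. This excludes slits and punctures, at which a
  convex extension need not have \<open>x \<mapsto> x \<bullet> y - q y\<close> as a lower bound.\<close>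

lemma lipschitz_domain_frontier_subset:
  assumes "lipschitz_domain \<Omega>"
  shows "frontier \<Omega> \<subseteq> closure (interior (- \<Omega>))"
proof
  fix z assume z: "z \<in> frontier \<Omega>"
  obtain U e n g L where U: "open U" "z \<in> U" and en: "norm e = 1" "norm n = 1" "e \<bullet> n = 0"
    and g: "L-lipschitz_on UNIV (g :: real \<Rightarrow> real)"
    and eq: "\<Omega> \<inter> U = {x \<in> U. g (x \<bullet> e) < x \<bullet> n}"
    using assms z unfolding lipschitz_domain_def
    by (elim conjE) (drule (1) bspec, elim exE conjE, rule that)
  define V where "V = U \<inter> {x. x \<bullet> n < g (x \<bullet> e)}"
  have "continuous_on UNIV g"
    using g by (rule lipschitz_on_continuous_on)
  then have "continuous_on UNIV (\<lambda>x. g (x \<bullet> e))"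
    by (rule continuous_on_compose2) (auto intro: continuous_intros)
  then have "open V"
    unfolding V_def using U(1) by (intro open_Int open_Collect_less continuous_intros)
  moreover have "V \<subseteq> - \<Omega>"
  proof
    fix x assume x: "x \<in> V"
    then have "x \<notin> \<Omega> \<inter> U" by (simp add: V_def eq)
    with x show "x \<in> - \<Omega>" by (simp add: V_def)
  qed
  ultimately have V: "V \<subseteq> interior (- \<Omega>)"
    by (rule interior_maximal[rotated])
  have "z \<notin> \<Omega>"
    using assms z frontier_open_subset by (auto simp: lipschitz_domain_def)
  then have "z \<bullet> n \<le> g (z \<bullet> e)"
    using U(2) eq by (metis (mono_tags, lifting) IntD1 mem_Collect_eq not_less)
  then have inV: "z - t *\<^sub>R n \<in> V" if "z - t *\<^sub>R n \<in> U" "0 < t" for t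
    using that en by (simp add: V_def inner_diff_left inner_commute[of n e] norm_eq_1)
  have lim: "((\<lambda>t. z - t *\<^sub>R n) \<longlongrightarrow> z) (at_right 0)"
    by (auto intro!: tendsto_eq_intros)
  then have "eventually (\<lambda>t. z - t *\<^sub>R n \<in> U) (at_right 0)"
    using U by (intro topological_tendstoD)
  then have "eventually (\<lambda>t. z - t *\<^sub>R n \<in> closure (interior (- \<Omega>))) (at_right 0)"
    using eventually_at_right_less[of "0::real"]
    by eventually_elim (use inV V closure_subset in blast)
  then show "z \<in> closure (interior (- \<Omega>))"
    using lim by (intro Lim_in_closed_set[of _ _ "at_right (0::real)"]) auto
qed

lemma convex_extension_ge_tangent:
  assumes "lipschitz_domain \<Omega>" "\<phi> \<in> convex_extensions \<Omega>" "y \<in> frontier \<Omega>"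
  shows "x \<bullet> y - half_sq y \<le> \<phi> x"
proof -
  have "closed {y. x \<bullet> y - half_sq y \<le> \<phi> x}"
    by (intro closed_Collect_le continuous_intros)
  then have "closure (interior (- \<Omega>)) \<subseteq> {y. x \<bullet> y - half_sq y \<le> \<phi> x}"
    using convex_extension_ge_tangent_interior[OF assms(2)] by (intro closure_minimal) auto
  then show ?thesis
    using lipschitz_domain_frontier_subset[OF assms(1)] assms(3) by blast
qed

text \<open>The segment from \<open>x\<close> to the nearest point of the complement already meets the boundary.\<close>

lemma infdist_complement_eq_infdist_frontier:
  fixes \<Omega> :: "'a::euclidean_space set"
  assumes "open \<Omega>" "\<Omega> \<noteq> UNIV" "x \<in> \<Omega>"
  shows "infdist x (- \<Omega>) = infdist x (frontier \<Omega>)"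
proof -
  have ne: "frontier \<Omega> \<noteq> {}"
    using assms by (auto simp: frontier_eq_empty)
  obtain y where y: "y \<in> - \<Omega>" "infdist x (- \<Omega>) = dist x y"
    using infdist_attains_inf[of "- \<Omega>" x] assms by (auto simp: closed_Compl)
  obtain s where s: "0 < s" "s \<le> 1" "x + s *\<^sub>R (y - x) \<in> frontier \<Omega>"
    using frontier_on_segment[OF assms(1,3)] y(1) by blast
  have "infdist x (frontier \<Omega>) \<le> dist x (x + s *\<^sub>R (y - x))"
    using s(3) by (rule infdist_le)
  also have "\<dots> = s * dist x y"
    using s(1) by (simp add: dist_norm norm_minus_commute)
  also have "\<dots> \<le> dist x y"
    using s by (simp add: mult_left_le_one_le)
  finally show ?thesis
    using infdist_mono[OF frontier_open_subset[OF assms(1)] ne, of x] y(2) by linarith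
qed

text \<open>By \<open>half_sq_tangent\<close> the function is the supremum over \<open>y\<close> in the complement of the affine
  functions \<open>x \<mapsto> x \<bullet> y - q y\<close>, attained at a nearest point. Off \<open>\<Omega>\<close> the distance is zero.\<close>

lemma infdist_function_in_convex_extensions:
  assumes "bounded \<Omega>" "open \<Omega>"
  shows "(\<lambda>x. half_sq x - 1/2 * (infdist x (- \<Omega>))\<^sup>2) \<in> convex_extensions \<Omega>" (is "?\<Psi> \<in> _")
proof -
  have ne: "- \<Omega> \<noteq> {}" using assms(1) not_bounded_UNIV by (metis Compl_UNIV_eq double_complement)
  have ge: "x \<bullet> y - half_sq y \<le> ?\<Psi> x" if "y \<in> - \<Omega>" for x y
  proof -
    have "(infdist x (- \<Omega>))\<^sup>2 \<le> (norm (x - y))\<^sup>2"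
      using infdist_le[OF that, of x] by (intro power_mono) (auto simp: dist_norm infdist_nonneg)
    then show ?thesis using half_sq_tangent[of x y] by simp
  qed
  have "convex_on UNIV ?\<Psi>"
  proof (rule convex_onI)
    fix t :: real and x y :: "real^2"
    assume t: "0 < t" "t < 1"
    let ?w = "(1 - t) *\<^sub>R x + t *\<^sub>R y"
    obtain v where v: "v \<in> - \<Omega>" "infdist ?w (- \<Omega>) = dist ?w v"
      using infdist_attains_inf[of "- \<Omega>" ?w] assms(2) ne by (auto simp: closed_Compl)
    then have "?\<Psi> ?w = ?w \<bullet> v - half_sq v"
      using half_sq_tangent[of ?w v] by (simp add: dist_norm)
    also have "\<dots> = (1 - t) * (x \<bullet> v - half_sq v) + t * (y \<bullet> v - half_sq v)"
      by (simp add: inner_simps field_simps)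
    also have "\<dots> \<le> (1 - t) * ?\<Psi> x + t * ?\<Psi> y"
      using t ge[OF v(1)] by (intro add_mono mult_left_mono) auto
    finally show "?\<Psi> ?w \<le> (1 - t) * ?\<Psi> x + t * ?\<Psi> y" .
  qed simp
  then show ?thesis
    by (simp add: convex_extensions_def)
qed

lemma phi_minus_le:
  assumes "bounded \<Omega>" "\<phi> \<in> convex_extensions \<Omega>"
  shows "phi_minus \<Omega> x \<le> \<phi> x"
  unfolding phi_minus_def
  using assms by (intro cINF_lower convex_extensions_values_bounded)

text \<open>Stated for all \<open>x\<close>, and therefore with the distance to the complement, which vanishes off \<open>\<Omega>\<close>;
  inside \<open>\<Omega>\<close> it is the distance to the boundary.\<close>

lemma phi_minus_eq_infdist_complement:
  assumes "bounded \<Omega>" "lipschitz_domain \<Omega>"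
  shows "phi_minus \<Omega> x = half_sq x - 1/2 * (infdist x (- \<Omega>))\<^sup>2"
proof (rule antisym)
  have op: "open \<Omega>" and nU: "\<Omega> \<noteq> UNIV"
    using assms not_bounded_UNIV by (auto simp: lipschitz_domain_def)
  show "phi_minus \<Omega> x \<le> half_sq x - 1/2 * (infdist x (- \<Omega>))\<^sup>2"
    using phi_minus_le[OF assms(1) infdist_function_in_convex_extensions[OF assms(1) op]] .
  have "half_sq x - 1/2 * (infdist x (- \<Omega>))\<^sup>2 \<le> \<phi> x" if \<phi>: "\<phi> \<in> convex_extensions \<Omega>" for \<phi>
  proof (cases "x \<in> \<Omega>")
    case True
    then have "frontier \<Omega> \<noteq> {}"
      using nU by (auto simp: frontier_eq_empty)
    then obtain y where y: "y \<in> frontier \<Omega>" "infdist x (frontier \<Omega>) = dist x y"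
      using infdist_attains_inf[of "frontier \<Omega>" x] by auto
    then show ?thesis
      using convex_extension_ge_tangent[OF assms(2) \<phi> y(1), of x] half_sq_tangent[of x y]
        infdist_complement_eq_infdist_frontier[OF op nU True]
      by (simp add: dist_norm)
  next
    case False
    with \<phi> show ?thesis by (simp add: convex_extensions_def)
  qed
  then show "half_sq x - 1/2 * (infdist x (- \<Omega>))\<^sup>2 \<le> phi_minus \<Omega> x"
    unfolding phi_minus_def using convex_extensions_values_bounded(1)[OF assms(1)]
    by (intro cINF_greatest) auto
qed

section \<open>The dual problem\<close>

lemma L2_mult_integrable:
  assumes "f \<in> L2 \<Omega>" "g \<in> L2 \<Omega>"
  shows "integrable (lebesgue_on \<Omega>) (\<lambda>x. f x * g x)"
proof (rule Bochner_Integration.integrable_bound)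
  show "integrable (lebesgue_on \<Omega>) (\<lambda>x. (f x)\<^sup>2 + (g x)\<^sup>2)"
    using assms by (simp add: L2_def)
  show "(\<lambda>x. f x * g x) \<in> borel_measurable (lebesgue_on \<Omega>)"
    using assms by (auto simp: L2_def)
  have "\<bar>a * b\<bar> \<le> a\<^sup>2 + b\<^sup>2" for a b :: real
  proof -
    have "2 * \<bar>a * b\<bar> \<le> a\<^sup>2 + b\<^sup>2"
      using sum_squares_bound[of "\<bar>a\<bar>" "\<bar>b\<bar>"] by (simp add: abs_mult)
    then show ?thesis by linarith
  qed
  then show "AE x in lebesgue_on \<Omega>. norm (f x * g x) \<le> norm ((f x)\<^sup>2 + (g x)\<^sup>2)"
    by simp
qed

lemma det_weak_hessian_integrable:
  fixes H :: "real^2 \<Rightarrow> real^2^2"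
  assumes "weak_hessian \<Omega> p H"
  shows "integrable (lebesgue_on \<Omega>) (\<lambda>x. det (H x))"
proof -
  have "(\<lambda>x. H x $ i $ j) \<in> L2 \<Omega>" for i j
    using assms by (simp add: weak_hessian_def L2_weak_partial_def)
  then show ?thesis
    unfolding det_2 by (intro Bochner_Integration.integrable_diff L2_mult_integrable)
qed

text \<open>A finite convex function on the plane is continuous, so \<open>\<phi> - q\<close> is bounded on the compact
  closure of \<open>\<Omega>\<close>.\<close>

lemma dual_integrand_integrable:
  assumes "bounded \<Omega>" "open \<Omega>" "weak_hessian \<Omega> p H" "\<phi> \<in> convex_extensions \<Omega>"
  shows "integrable (lebesgue_on \<Omega>) (dual_integrand H \<phi>)"
proof -
  have cont: "continuous_on UNIV (\<lambda>x. \<phi> x - half_sq x)"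
    using assms(4) by (intro continuous_intros convex_on_continuous) (auto simp: convex_extensions_def)
  have "bounded ((\<lambda>x. \<phi> x - half_sq x) ` closure \<Omega>)"
    using assms(1) cont
    by (intro compact_imp_bounded compact_continuous_image) (auto intro: continuous_on_subset)
  then obtain B where B: "\<And>x. x \<in> \<Omega> \<Longrightarrow> \<bar>\<phi> x - half_sq x\<bar> \<le> B"
    unfolding bounded_iff using closure_subset[of \<Omega>] by auto
  have meas: "\<Omega> \<in> sets lebesgue"
    using assms(2) by simp
  have "(\<lambda>x. \<phi> x - half_sq x) \<in> borel_measurable (lebesgue_on \<Omega>)"
    using cont meas by (intro continuous_imp_measurable_on_sets_lebesgue) (auto intro: continuous_on_subset)
  moreover have det: "integrable (lebesgue_on \<Omega>) (\<lambda>x. det (H x))"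
    using assms(3) by (rule det_weak_hessian_integrable)
  ultimately have mult_meas: "(\<lambda>x. (\<phi> x - half_sq x) * det (H x)) \<in> borel_measurable (lebesgue_on \<Omega>)"
    by (intro borel_measurable_times) (auto intro: borel_measurable_integrable)
  have "norm ((\<phi> x - half_sq x) * det (H x)) \<le> norm (B * det (H x))" if "x \<in> \<Omega>" for x
    unfolding real_norm_def abs_mult
    using B[OF that] by (intro mult_right_mono) linarith+
  then have bound: "AE x in lebesgue_on \<Omega>. norm ((\<phi> x - half_sq x) * det (H x)) \<le> norm (B * det (H x))"
    by (intro AE_I2) (metis Int_iff space_restrict_space)
  have "integrable (lebesgue_on \<Omega>) (\<lambda>x. (\<phi> x - half_sq x) * det (H x))"
    using integrable_mult_right[OF det, of B] mult_meas bound
    by (rule Bochner_Integration.integrable_bound)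
  then show ?thesis
    by (simp add: dual_integrand_def[abs_def])
qed

lemma solves_dualI:
  assumes "bounded \<Omega>" "open \<Omega>" "weak_hessian \<Omega> p H" "\<phi> \<in> convex_extensions \<Omega>"
    and "\<And>\<psi>. \<psi> \<in> convex_extensions \<Omega> \<Longrightarrow>
      AE x in lebesgue_on \<Omega>. dual_integrand H \<psi> x \<le> dual_integrand H \<phi> x"
  shows "solves_dual \<Omega> H \<phi>"
  unfolding solves_dual_def
  using assms by (auto intro!: integral_mono_AE dual_integrand_integrable)

theorem proposition1p1:
  fixes \<Omega> :: "(real^2) set" and p :: "real^2 \<Rightarrow> real" and H :: "real^2 \<Rightarrow> real^2^2"
  assumes "bounded \<Omega>" and "lipschitz_domain \<Omega>" and "simply_connected \<Omega>"
    and "p \<in> sobolev_W2 2 \<Omega>" and "weak_hessian \<Omega> p H"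
  shows "((AE x in lebesgue_on \<Omega>. det (H x) \<ge> 0) \<longrightarrow> solves_dual \<Omega> H (phi_plus \<Omega>))
    \<and> (\<forall>x\<in>\<Omega>. is_minimum_of (phi_plus \<Omega> x) (boundary_combination_values \<Omega> x))
    \<and> ((AE x in lebesgue_on \<Omega>. det (H x) \<le> 0) \<longrightarrow> solves_dual \<Omega> H (phi_minus \<Omega>))
    \<and> (\<forall>x\<in>\<Omega>. is_minimum_of (infdist x (frontier \<Omega>)) ((\<lambda>y. norm (x - y)) ` frontier \<Omega>)
           \<and> phi_minus \<Omega> x = 1/2 * (norm x)\<^sup>2 - 1/2 * (infdist x (frontier \<Omega>))\<^sup>2)"
proof (intro conjI impI ballI)
  have op: "open \<Omega>" and nU: "\<Omega> \<noteq> UNIV"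
    using assms(1,2) not_bounded_UNIV by (auto simp: lipschitz_domain_def)
  show "solves_dual \<Omega> H (phi_plus \<Omega>)" if "AE x in lebesgue_on \<Omega>. det (H x) \<ge> 0"
  proof (rule solves_dualI[OF assms(1) op assms(5) phi_plus_in_convex_extensions[OF assms(1)]])
    fix \<psi> assume "\<psi> \<in> convex_extensions \<Omega>"
    then show "AE x in lebesgue_on \<Omega>. dual_integrand H \<psi> x \<le> dual_integrand H (phi_plus \<Omega>) x"
      using that le_phi_plus[OF assms(1)]
      by (auto simp: dual_integrand_def elim!: eventually_mono intro!: mult_right_mono)
  qed
  show "is_minimum_of (phi_plus \<Omega> x) (boundary_combination_values \<Omega> x)" if "x \<in> \<Omega>" for x
    using assms(1) op that by (rule phi_plus_is_minimum)
  have "phi_minus \<Omega> \<in> convex_extensions \<Omega>"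
    using infdist_function_in_convex_extensions[OF assms(1) op]
    by (simp add: phi_minus_eq_infdist_complement[OF assms(1,2), abs_def])
  then show "solves_dual \<Omega> H (phi_minus \<Omega>)" if "AE x in lebesgue_on \<Omega>. det (H x) \<le> 0"
  proof (rule solves_dualI[OF assms(1) op assms(5)])
    fix \<psi> assume "\<psi> \<in> convex_extensions \<Omega>"
    then show "AE x in lebesgue_on \<Omega>. dual_integrand H \<psi> x \<le> dual_integrand H (phi_minus \<Omega>) x"
      using that phi_minus_le[OF assms(1)]
      by (auto simp: dual_integrand_def elim!: eventually_mono intro!: mult_right_mono_neg)
  qed
  fix x assume x: "x \<in> \<Omega>"
  then have "frontier \<Omega> \<noteq> {}"
    using nU by (auto simp: frontier_eq_empty)
  then show "is_minimum_of (infdist x (frontier \<Omega>)) ((\<lambda>y. norm (x - y)) ` frontier \<Omega>)"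
    using infdist_attains_inf[of "frontier \<Omega>" x] infdist_le[of _ "frontier \<Omega>" x]
    by (auto simp: is_minimum_of_def dist_norm)
  show "phi_minus \<Omega> x = 1/2 * (norm x)\<^sup>2 - 1/2 * (infdist x (frontier \<Omega>))\<^sup>2"
    using phi_minus_eq_infdist_complement[OF assms(1,2)] infdist_complement_eq_infdist_frontier[OF op nU x] by simp
qed

end
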